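(* Let $\tau>0$, $u^0_{\delta,\varepsilon}\in U$, and let the sequences $(u^k_{\delta,\varepsilon})_{k\ge0}\subset U$ and $(r^k_\delta)_{k\ge0}\subset V$ be generated by the inexact Uzawa iteration: for $k=0,1,2,\dots$, $r^k_\delta\in V$ is an approximation of $$r^k:=R_V^{-1}(\ell-Bu^k_{\delta,\varepsilon}),$$ and $u^{k+1}_{\delta,\varepsilon}\in U$ is an approximation of $$u^{k+1}_\delta:=u^k_{\delta,\varepsilon}+\tau R_U^{-1}B^*r^k_\delta .$$ Assume that for all $k\ge0$ $$\|r^k_\delta-r^k\|\le\delta\|r^k\|,\qquad \|u^{k+1}_{\delta,\varepsilon}-u^{k+1}_\delta\|\le\varepsilon\|u^k_{\delta,\varepsilon}-u^{k+1}_\delta\|,$$ with $\delta>0$, $\varepsilon>0$ and $$\delta+\varepsilon(1+\delta)<\frac{1-\gamma}{\tau M^2},$$ where $\gamma=\|I-\tau R_U^{-1}B^*R_V^{-1}B\|=\max\{|1-\tau m^2|,|1-\tau M^2|\}<1$. Then $u^k_{\delta,\varepsilon}\to u^*$ in $U$ and $r^k_\delta\to r^*$ in $V$ as $k\to\infty$, where $(r^*,u^* )\in V\times U$ is the solution of the saddle-point problem $$(r^*,v)_V+b(u^*,v)=\ell(v)\quad\forall v\in V,\qquad b(w,r^* )=0\quad\forall w\in U.$$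
   Context: $U$ and $V$ are real Hilbert spaces (trial and test spaces) with duals $U^*$, $V^*$; norms are those of $U$ and $V$ (and the induced operator norm on $U$). $b:U\times V\to\mathbb{R}$ is a bilinear form, $\ell\in V^*$ a continuous linear functional, and the underlying variational problem is: find $u\in U$ such that $b(u,v)=\ell(v)$ for all $v\in V$, equivalently $Bu=\ell$ in $V^*$, where $B:U\to V^*$ is defined by $\langle Bu,v\rangle_{V^*,V}=b(u,v)$. There are constants $0<m\le M$ with $m\|u\|_U\le\|Bu\|_{V^*}\le M\|u\|_U$ for all $u\in U$. $B^*:V\to U^*$ is the dual operator, $\langle B^*v,u\rangle_{U^*,U}=b(u,v)$. $R_U:U\to U^*$ and $R_V:V\to V^*$ are the Riesz maps, $\langle R_Uu,w\rangle_{U^*,U}=(u,w)_U$ and $\langle R_Vr,v\rangle_{V^*,V}=(r,v)_V$.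
   Formalization: It is additionally assumed that Bu=ℓ has a solution (so r*=0); otherwise r*≠0 and u^k=u*, r^k_δ=(1+δ)r* is a counterexample. The formula γ=max{|1-τm²|,|1-τM²|} is proved for the best constants m, M; γ itself is the operator norm. *)

theory Defs
  imports "HOL-Analysis.Analysis"
begin

text \<open>
  Real Hilbert spaces are types of sort \<open>{real_inner, complete_space}\<close>; the dual of \<open>'a\<close> is
  \<open>'a \<Rightarrow>\<^sub>L real\<close> with its operator norm.
\<close>

definition riesz :: "'a::{real_inner, complete_space} \<Rightarrow> ('a \<Rightarrow>\<^sub>L real)" where
  "riesz x = Blinfun (\<lambda>y. x \<bullet> y)"

text \<open>
  \<open>inv riesz\<close> is the genuine inverse, because \<open>riesz\<close> is bijective on a Hilbert space.
\<close>

abbreviation riesz_inv :: "('a::{real_inner, complete_space} \<Rightarrow>\<^sub>L real) \<Rightarrow> 'a" where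
  "riesz_inv \<equiv> inv riesz"

text \<open>
  The operators \<open>B : U \<rightarrow> V\<^sup>*\<close> and \<open>B\<^sup>* : V \<rightarrow> U\<^sup>*\<close> induced by a bilinear form \<open>b\<close>. They have the
  intended values as soon as \<open>b\<close> is continuous in each argument separately, since otherwise
  \<open>Blinfun\<close> is applied outside its domain.
\<close>

definition form_op ::
  "('u::{real_inner, complete_space} \<Rightarrow> 'v::{real_inner, complete_space} \<Rightarrow> real) \<Rightarrow> 'u \<Rightarrow> ('v \<Rightarrow>\<^sub>L real)"
  where "form_op b u = Blinfun (\<lambda>v. b u v)"

definition form_dual ::
  "('u::{real_inner, complete_space} \<Rightarrow> 'v::{real_inner, complete_space} \<Rightarrow> real) \<Rightarrow> 'v \<Rightarrow> ('u \<Rightarrow>\<^sub>L real)"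
  where "form_dual b v = Blinfun (\<lambda>u. b u v)"

definition exact_residual ::
  "('u::{real_inner, complete_space} \<Rightarrow> 'v::{real_inner, complete_space} \<Rightarrow> real) \<Rightarrow> ('v \<Rightarrow>\<^sub>L real) \<Rightarrow> 'u \<Rightarrow> 'v"
  where "exact_residual b l u = riesz_inv (l - form_op b u)"

definition exact_update ::
  "('u::{real_inner, complete_space} \<Rightarrow> 'v::{real_inner, complete_space} \<Rightarrow> real) \<Rightarrow> real \<Rightarrow> 'u \<Rightarrow> 'v \<Rightarrow> 'u"
  where "exact_update b \<tau> u r = u + \<tau> *\<^sub>R riesz_inv (form_dual b r)"

definition uzawa_op ::
  "('u::{real_inner, complete_space} \<Rightarrow> 'v::{real_inner, complete_space} \<Rightarrow> real) \<Rightarrow> real \<Rightarrow> 'u \<Rightarrow> 'u"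
  where "uzawa_op b \<tau> u = u - \<tau> *\<^sub>R riesz_inv (form_dual b (riesz_inv (form_op b u)))"

definition saddle_point ::
  "('u::{real_inner, complete_space} \<Rightarrow> 'v::{real_inner, complete_space} \<Rightarrow> real) \<Rightarrow> ('v \<Rightarrow>\<^sub>L real) \<Rightarrow> 'v \<Rightarrow> 'u \<Rightarrow> bool"
  where "saddle_point b l r u \<longleftrightarrow>
    (\<forall>v. r \<bullet> v + b u v = blinfun_apply l v) \<and> (\<forall>w. b w r = 0)"

text \<open>
  \<open>m\<close> is the largest and \<open>M\<close> the smallest constant in \<open>m \<parallel>u\<parallel> \<le> \<parallel>B u\<parallel> \<le> M \<parallel>u\<parallel>\<close>. The norm
  of \<open>uzawa_op b \<tau>\<close> equals \<open>max \<bar>1 - \<tau> m\<^sup>2\<bar> \<bar>1 - \<tau> M\<^sup>2\<bar>\<close> for these constants; for other admissible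
  ones the maximum is in general only an upper bound.
\<close>

definition sharp_bounds ::
  "('u::{real_inner, complete_space} \<Rightarrow> 'v::{real_inner, complete_space} \<Rightarrow> real) \<Rightarrow> real \<Rightarrow> real \<Rightarrow> bool"
  where "sharp_bounds b m M \<longleftrightarrow>
    (\<forall>c. (\<forall>u. c * norm u \<le> norm (form_op b u)) \<longrightarrow> c \<le> m) \<and>
    (\<forall>C. (\<forall>u. norm (form_op b u) \<le> C * norm u) \<longrightarrow> M \<le> C)"

end

theory Submission
  imports Defs
begin

text \<open>
  Let \<open>S = R\<^sub>V\<^sup>-\<^sup>1 B\<close>, an operator from \<open>U\<close> to \<open>V\<close>. Since \<open>R\<^sub>V\<close> is an isometry, \<open>\<parallel>S x\<parallel> = \<parallel>B x\<parallel>\<close>; and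
  \<open>R\<^sub>U\<^sup>-\<^sup>1 B\<^sup>*\<close> is exactly the Hilbert space adjoint \<open>S\<^sup>*\<close> of \<open>S\<close>. Hence the iteration operator is
  \<open>T = I - \<tau> S\<^sup>* S\<close>.

  \<^emph>\<open>The value of the norm.\<close> \<open>T\<close> is symmetric, so its norm is the supremum of its absolute Rayleigh
  quotients \<open>\<bar>1 - \<tau> \<parallel>S x\<parallel>\<^sup>2 / \<parallel>x\<parallel>\<^sup>2\<bar>\<close> (lemma \<open>symmetric_norm_le_of_quadratic_form\<close>). The quotient
  \<open>\<parallel>S x\<parallel> / \<parallel>x\<parallel>\<close> lies between \<open>m\<close> and \<open>M\<close>, and comes arbitrarily close to both when these are sharp.
  The absolute value of an affine function on an interval is largest at an end point, whence the
  maximum of the two values.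

  \<^emph>\<open>Convergence.\<close> The functional \<open>\<ell>\<close> is in the range of \<open>B\<close>, say \<open>\<ell> = B u\<^sup>*\<close>, so the saddle point is
  \<open>(0, u\<^sup>*)\<close>. With the error \<open>e = u\<^sup>k - u\<^sup>*\<close> the exact residual is \<open>-S e\<close>, of norm at most \<open>M \<parallel>e\<parallel>\<close>.
  One exact step multiplies the error by \<open>T\<close>. The inexact residual disturbs this by at most
  \<open>\<tau> M (\<delta> M \<parallel>e\<parallel>)\<close>, and the inexact update by at most \<open>\<epsilon> \<tau> M ((1 + \<delta>) M \<parallel>e\<parallel>)\<close>.
  Altogether the error shrinks by the factor \<open>\<gamma> + \<tau> M\<^sup>2 (\<delta> + \<epsilon> (1 + \<delta>))\<close>
  (lemma \<open>inexact_step_error\<close>), which is less than \<open>1\<close> precisely by the smallness condition. The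
  residuals are controlled by the errors and tend to \<open>0\<close> with them.
\<close>

section \<open>The Riesz isometry of a Hilbert space\<close>

text \<open>
  The representer is the minimiser of \<open>J x = \<parallel>x\<parallel>\<^sup>2 - 2 f x\<close>. By the parallelogram law a minimising
  sequence is a Cauchy sequence, and the vanishing of the derivative of \<open>J\<close> at the minimiser \<open>z\<close> is
  the equation \<open>f y = z \<bullet> y\<close>.
\<close>

lemma bounded_linear_imp_inner:
  fixes f :: "'a::{real_inner, complete_space} \<Rightarrow> real"
  assumes "bounded_linear f"
  obtains z where "\<And>y. f y = z \<bullet> y"
proof -
  interpret f: bounded_linear f by fact
  define J where "J x = x \<bullet> x - 2 * f x" for x
  obtain K where K: "\<And>x. norm (f x) \<le> norm x * K"
    using f.bounded by blast
  have bdd: "bdd_below (range J)"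
  proof (rule bdd_belowI2)
    fix x :: 'a
    have "- (K\<^sup>2) \<le> (norm x)\<^sup>2 - 2 * (norm x * K)"
      using zero_le_power2[of "norm x - K"] by (simp add: power2_diff)
    also have "\<dots> \<le> J x"
      using K[of x] by (simp add: J_def power2_norm_eq_inner)
    finally show "- (K\<^sup>2) \<le> J x" .
  qed
  define d where "d = Inf (range J)"
  have d_le: "d \<le> J x" for x
    unfolding d_def by (rule cInf_lower[OF _ bdd]) simp
  have parallelogram: "(norm (x - y))\<^sup>2 = 2 * (J x + J y - 2 * J ((1/2) *\<^sub>R (x + y)))" for x y
    by (simp add: J_def power2_norm_eq_inner f.scaleR f.add inner_commute algebra_simps)
  have close: "(norm (x - y))\<^sup>2 \<le> 2 * ((J x - d) + (J y - d))" for x y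
    unfolding parallelogram using d_le[of "(1/2) *\<^sub>R (x + y)"] by simp
  have "\<exists>x. J x < d + 1 / real (Suc n)" for n
  proof -
    have "Inf (range J) < d + 1 / real (Suc n)"
      by (simp add: d_def)
    then show ?thesis
      using cInf_less_iff[of "range J"] bdd by auto
  qed
  then obtain x where x: "\<And>n. J (x n) < d + 1 / real (Suc n)"
    by metis
  have "Cauchy x"
  proof (rule metric_CauchyI)
    fix e :: real
    assume "0 < e"
    then obtain N where N: "1 / real (Suc N) < e\<^sup>2 / 4"
      using reals_Archimedean[of "e\<^sup>2 / 4"] by (auto simp: inverse_eq_divide)
    have small: "J (x n) - d < e\<^sup>2 / 4" if "n \<ge> N" for n
    proof -
      have "1 / real (Suc n) \<le> 1 / real (Suc N)"
        using that by (simp add: frac_le)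
      then show ?thesis using x[of n] N by linarith
    qed
    have "dist (x i) (x j) < e" if "i \<ge> N" "j \<ge> N" for i j
    proof -
      have "(norm (x i - x j))\<^sup>2 < e\<^sup>2"
        using close[of "x i" "x j"] add_strict_mono[OF small[OF that(1)] small[OF that(2)]] by simp
      then show ?thesis
        using \<open>0 < e\<close> by (simp add: dist_norm power_less_imp_less_base)
    qed
    then show "\<exists>N. \<forall>i\<ge>N. \<forall>j\<ge>N. dist (x i) (x j) < e" by blast
  qed
  then obtain z where z: "x \<longlonglongrightarrow> z"
    using Cauchy_convergent convergent_def by blast
  have "(\<lambda>n. J (x n)) \<longlonglongrightarrow> J z"
    unfolding J_def by (intro tendsto_intros f.tendsto z)
  moreover have "(\<lambda>n. d + 1 / real (Suc n)) \<longlonglongrightarrow> d + 0"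
    by (intro tendsto_intros LIMSEQ_Suc[OF lim_1_over_n])
  ultimately have "J z \<le> d + 0"
    by (rule LIMSEQ_le) (use x less_imp_le in blast)
  then have min: "J z \<le> J y" for y
    using d_le[of y] by linarith
  have "f y = z \<bullet> y" for y
  proof -
    define a where "a = z \<bullet> y - f y"
    define t where "t = 1 / (y \<bullet> y + 1)"
    have pos: "0 < y \<bullet> y + 1"
      using inner_ge_zero[of y] by linarith
    then have t: "0 < t" and "t * (y \<bullet> y + 1) = 1"
      by (simp_all add: t_def)
    \<comment> \<open>A descent step of length \<open>t a\<close>, short enough for its quadratic term not to cancel the gain.\<close>
    have "J (z - (t * a) *\<^sub>R y) = J z - 2 * t * a\<^sup>2 + t * a\<^sup>2 * (t * (y \<bullet> y))"
      by (simp add: J_def a_def f.add f.diff f.scaleR inner_commute algebra_simps power2_eq_square)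
    moreover have "t * (y \<bullet> y) \<le> 1"
      using \<open>t * (y \<bullet> y + 1) = 1\<close> t by (simp add: algebra_simps)
    then have "t * a\<^sup>2 * (t * (y \<bullet> y)) \<le> t * a\<^sup>2"
      using t mult_left_le[of "t * (y \<bullet> y)" "t * a\<^sup>2"] by simp
    ultimately have "t * a\<^sup>2 \<le> 0"
      using min[of "z - (t * a) *\<^sub>R y"] by linarith
    then have "a = 0"
      using t by (simp add: mult_le_0_iff)
    then show ?thesis by (simp add: a_def)
  qed
  then show thesis using that by blast
qed

lemma riesz_apply [simp]: "blinfun_apply (riesz x) y = x \<bullet> y"
  by (simp add: riesz_def bounded_linear_Blinfun_apply bounded_linear_inner_right)

lemma bij_riesz: "bij (riesz :: 'a::{real_inner, complete_space} \<Rightarrow> _)" (is "bij ?R")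
proof (rule bijI)
  show "inj ?R"
    by (rule injI) (metis riesz_apply vector_eq_rdot)
  show "surj ?R"
    unfolding surj_def
  proof
    fix \<phi> :: "'a \<Rightarrow>\<^sub>L real"
    obtain z where "\<And>y. blinfun_apply \<phi> y = z \<bullet> y"
      using bounded_linear_imp_inner[OF blinfun.bounded_linear_right] by blast
    then have "\<phi> = riesz z"
      by (intro blinfun_eqI) simp
    then show "\<exists>z. \<phi> = riesz z" ..
  qed
qed

lemma inner_riesz_inv: "riesz_inv \<phi> \<bullet> y = blinfun_apply \<phi> y"
  by (metis bij_is_surj bij_riesz riesz_apply surj_f_inv_f)

lemma norm_riesz_inv: "norm (riesz_inv \<phi>) = norm \<phi>"
proof (rule antisym)
  let ?z = "riesz_inv \<phi>"
  have "norm ?z * norm ?z = blinfun_apply \<phi> ?z"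
    by (metis inner_riesz_inv norm_eq_sqrt_inner real_sqrt_mult_self abs_of_nonneg inner_ge_zero)
  also have "\<dots> \<le> norm \<phi> * norm ?z"
    using norm_blinfun[of \<phi> ?z] by simp
  finally show "norm ?z \<le> norm \<phi>"
    by (metis mult_right_le_imp_le norm_ge_zero norm_zero zero_less_norm_iff)
  show "norm \<phi> \<le> norm ?z"
    by (rule norm_blinfun_bound) (auto simp flip: inner_riesz_inv intro: Cauchy_Schwarz_ineq2)
qed

section \<open>Norms of symmetric operators\<close>

text \<open>
  By polarisation, symmetry turns a bound on the quadratic form into one on
  \<open>4 (T x \<bullet> y) \<le> c (\<parallel>x + y\<parallel>\<^sup>2 + \<parallel>x - y\<parallel>\<^sup>2) = 2 c (\<parallel>x\<parallel>\<^sup>2 + \<parallel>y\<parallel>\<^sup>2)\<close>. It remains to insert for \<open>y\<close> the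
  vector in the direction of \<open>T x\<close> whose length is that of \<open>x\<close>.
\<close>

lemma symmetric_norm_le_of_quadratic_form:
  fixes T :: "'a::real_inner \<Rightarrow> 'a"
  assumes "linear T"
    and sym: "\<And>x y. T x \<bullet> y = x \<bullet> T y"
    and quad: "\<And>x. \<bar>T x \<bullet> x\<bar> \<le> c * (norm x)\<^sup>2"
  shows "norm (T x) \<le> c * norm x"
proof (cases "T x = 0 \<or> x = 0")
  case True
  then show ?thesis
  proof
    assume "x = 0"
    then show ?thesis by (simp add: linear_0[OF \<open>linear T\<close>])
  next
    assume "T x = 0"
    have "0 \<le> c * (norm x)\<^sup>2" using quad[of x] by (meson abs_ge_zero order_trans)
    then have "0 \<le> c * norm x"
      by (cases "x = 0") (auto simp: zero_le_mult_iff)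
    then show ?thesis using \<open>T x = 0\<close> by simp
  qed
next
  case False
  then have nT: "norm (T x) > 0" and nx: "norm x > 0" by auto
  define y where "y = (norm x / norm (T x)) *\<^sub>R T x"
  have ny: "norm y = norm x" and Ty: "T x \<bullet> y = norm x * norm (T x)"
    using nT by (simp_all add: y_def power2_norm_eq_inner[symmetric] power2_eq_square)
  have "4 * (T x \<bullet> y) = T (x + y) \<bullet> (x + y) - T (x - y) \<bullet> (x - y)"
    using sym[of x y] sym[of y x]
    by (simp add: linear_add[OF \<open>linear T\<close>] linear_diff[OF \<open>linear T\<close>] inner_commute algebra_simps)
  also have "\<dots> \<le> c * (norm (x + y))\<^sup>2 + c * (norm (x - y))\<^sup>2"
    using quad[of "x + y"] quad[of "x - y"] by linarith
  also have "\<dots> = c * (2 * (norm x)\<^sup>2 + 2 * (norm y)\<^sup>2)"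
    by (simp add: power2_norm_eq_inner inner_commute algebra_simps)
  finally have "norm x * norm (T x) \<le> norm x * (c * norm x)"
    using ny Ty by (simp add: power2_eq_square algebra_simps)
  then show ?thesis using nx by simp
qed

section \<open>The operator of a bounded bilinear form and its adjoint\<close>

locale bounded_form =
  fixes b :: "'u::{real_inner, complete_space} \<Rightarrow> 'v::{real_inner, complete_space} \<Rightarrow> real"
    and M :: real
  assumes bilin: "bilinear b"
    and B_welldef: "\<And>x. bounded_linear (b x)"
    and B_upper: "\<And>x. norm (form_op b x) \<le> M * norm x"
    and M_nonneg: "0 \<le> M"
begin

definition S :: "'u \<Rightarrow> 'v" where
  "S x = riesz_inv (form_op b x)"

text \<open>The Hilbert space adjoint of \<open>S\<close>, by lemma \<open>S_adj_inner\<close>.\<close>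

definition S_adj :: "'v \<Rightarrow> 'u" where
  "S_adj v = riesz_inv (form_dual b v)"

lemma form_op_apply: "blinfun_apply (form_op b x) v = b x v"
  by (simp add: form_op_def bounded_linear_Blinfun_apply B_welldef)

lemma norm_S: "norm (S x) = norm (form_op b x)"
  by (simp add: S_def norm_riesz_inv)

lemma norm_S_le: "norm (S x) \<le> M * norm x"
  by (simp add: norm_S B_upper)

lemma S_inner: "S x \<bullet> v = b x v"
  by (simp add: S_def inner_riesz_inv form_op_apply)

lemma linear_S: "linear S"
  by (rule linearI; rule vector_eq_rdot[THEN iffD1])
    (simp_all add: S_inner inner_add_left bilinear_ladd[OF bilin] bilinear_lmul[OF bilin])

lemma bounded_linear_left: "bounded_linear (\<lambda>x. b x v)"
proof (rule bounded_linear_intro)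
  show "norm (b x v) \<le> norm x * (M * norm v)" for x
    using Cauchy_Schwarz_ineq2[of "S x" v] mult_right_mono[OF norm_S_le[of x], of "norm v"]
    by (simp add: S_inner mult.commute mult.left_commute)
qed (simp_all add: bilinear_ladd[OF bilin] bilinear_lmul[OF bilin])

lemma S_adj_inner: "S_adj v \<bullet> x = v \<bullet> S x"
  by (simp add: S_adj_def inner_riesz_inv form_dual_def bounded_linear_Blinfun_apply
      bounded_linear_left S_inner inner_commute[of v])

lemma linear_S_adj: "linear S_adj"
  by (rule linearI; rule vector_eq_rdot[THEN iffD1]) (simp_all add: S_adj_inner inner_add_left)

lemma norm_S_adj_le: "norm (S_adj v) \<le> M * norm v"
proof (cases "S_adj v = 0")
  case False
  have "norm (S_adj v) * norm (S_adj v) = v \<bullet> S (S_adj v)"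
    by (simp flip: S_adj_inner power2_norm_eq_inner power2_eq_square)
  also have "\<dots> \<le> norm v * norm (S (S_adj v))"
    by (rule norm_cauchy_schwarz)
  also have "\<dots> \<le> norm v * (M * norm (S_adj v))"
    by (intro mult_left_mono norm_S_le) simp
  finally have "norm (S_adj v) * norm (S_adj v) \<le> (M * norm v) * norm (S_adj v)"
    by (simp add: mult_ac)
  then show ?thesis using False by simp
qed (simp add: M_nonneg)

section \<open>The norm of the iteration operator\<close>

lemma uzawa_op_eq: "uzawa_op b \<tau> x = x - \<tau> *\<^sub>R S_adj (S x)"
  by (simp add: uzawa_op_def S_def S_adj_def)

lemma bounded_linear_uzawa_op: "bounded_linear (uzawa_op b \<tau>)"
proof (rule bounded_linear_intro)
  show "norm (uzawa_op b \<tau> x) \<le> norm x * (1 + \<bar>\<tau>\<bar> * (M * M))" for x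
  proof -
    have "norm (S_adj (S x)) \<le> M * (M * norm x)"
      using norm_S_adj_le[of "S x"] mult_left_mono[OF norm_S_le M_nonneg, of x] by linarith
    then have "norm (\<tau> *\<^sub>R S_adj (S x)) \<le> \<bar>\<tau>\<bar> * (M * (M * norm x))"
      by (simp add: mult_left_mono)
    then show ?thesis
      using norm_triangle_ineq4[of x "\<tau> *\<^sub>R S_adj (S x)"]
      by (simp add: uzawa_op_eq algebra_simps)
  qed
qed (simp_all add: uzawa_op_eq linear_add[OF linear_S] linear_add[OF linear_S_adj]
      linear_scale[OF linear_S] linear_scale[OF linear_S_adj] algebra_simps)

lemma uzawa_op_symmetric: "uzawa_op b \<tau> x \<bullet> y = x \<bullet> uzawa_op b \<tau> y"
  by (simp add: uzawa_op_eq inner_diff_left inner_diff_right S_adj_inner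
      inner_commute[of x "S_adj _"] inner_commute[of "S y"])

lemma uzawa_op_quadratic_form: "uzawa_op b \<tau> x \<bullet> x = (norm x)\<^sup>2 - \<tau> * (norm (S x))\<^sup>2"
  by (simp add: uzawa_op_eq inner_diff_left S_adj_inner power2_norm_eq_inner)

lemma uzawa_quadratic_form_le_onorm:
  "\<bar>(norm x)\<^sup>2 - \<tau> * (norm (S x))\<^sup>2\<bar> \<le> onorm (uzawa_op b \<tau>) * (norm x)\<^sup>2"
proof -
  have "\<bar>uzawa_op b \<tau> x \<bullet> x\<bar> \<le> norm (uzawa_op b \<tau> x) * norm x"
    by (rule Cauchy_Schwarz_ineq2)
  also have "\<dots> \<le> (onorm (uzawa_op b \<tau>) * norm x) * norm x"
    by (intro mult_right_mono onorm[OF bounded_linear_uzawa_op]) simp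
  finally show ?thesis
    by (simp add: uzawa_op_quadratic_form power2_eq_square mult_ac)
qed

text \<open>
  The Rayleigh quotient of \<open>I - \<tau> S\<^sup>* S\<close> at \<open>x\<close> is \<open>1 - \<tau> t\<close> with \<open>t = \<parallel>S x\<parallel>\<^sup>2 / \<parallel>x\<parallel>\<^sup>2\<close> between \<open>m\<^sup>2\<close> and
  \<open>M\<^sup>2\<close>. It decreases in \<open>t\<close>, so \<open>m\<close> bounds it from above and \<open>M\<close> from below.
\<close>

lemma onorm_uzawa_op_le:
  assumes "0 \<le> m" "0 \<le> \<tau>" and lower: "\<And>x. m * norm x \<le> norm (form_op b x)"
  shows "onorm (uzawa_op b \<tau>) \<le> max \<bar>1 - \<tau> * m\<^sup>2\<bar> \<bar>1 - \<tau> * M\<^sup>2\<bar>" (is "_ \<le> ?c")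
proof (rule onorm_bound)
  show "0 \<le> ?c"
    by (simp add: le_max_iff_disj)
  fix x
  show "norm (uzawa_op b \<tau> x) \<le> ?c * norm x"
  proof (rule symmetric_norm_le_of_quadratic_form)
    show "linear (uzawa_op b \<tau>)"
      using bounded_linear_uzawa_op by (rule bounded_linear.linear)
    show "uzawa_op b \<tau> x \<bullet> y = x \<bullet> uzawa_op b \<tau> y" for x y
      by (rule uzawa_op_symmetric)
    show "\<bar>uzawa_op b \<tau> x \<bullet> x\<bar> \<le> ?c * (norm x)\<^sup>2" for x
    proof -
      have "(m * norm x)\<^sup>2 \<le> (norm (S x))\<^sup>2" "(norm (S x))\<^sup>2 \<le> (M * norm x)\<^sup>2"
        unfolding norm_S using \<open>0 \<le> m\<close> by (auto intro!: power_mono lower B_upper)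
      then have "\<tau> * (m\<^sup>2 * (norm x)\<^sup>2) \<le> \<tau> * (norm (S x))\<^sup>2"
        "\<tau> * (norm (S x))\<^sup>2 \<le> \<tau> * (M\<^sup>2 * (norm x)\<^sup>2)"
        using \<open>0 \<le> \<tau>\<close> by (auto intro: mult_left_mono simp: power_mult_distrib)
      moreover have "(1 - \<tau> * m\<^sup>2) * (norm x)\<^sup>2 \<le> ?c * (norm x)\<^sup>2"
        "- (1 - \<tau> * M\<^sup>2) * (norm x)\<^sup>2 \<le> ?c * (norm x)\<^sup>2"
        by (intro mult_right_mono; simp add: le_max_iff_disj abs_if)+
      ultimately show ?thesis
        unfolding uzawa_op_quadratic_form by (simp add: algebra_simps abs_le_iff)
    qed
  qed
qed

text \<open>
  If \<open>\<gamma>\<close> is the norm, the Rayleigh quotients give \<open>1 - \<gamma> \<le> \<tau> \<parallel>S x\<parallel>\<^sup>2 / \<parallel>x\<parallel>\<^sup>2 \<le> 1 + \<gamma>\<close>. So the square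
  roots of \<open>(1 - \<gamma>) / \<tau>\<close> and \<open>(1 + \<gamma>) / \<tau>\<close> are admissible bounds for \<open>\<parallel>B x\<parallel> / \<parallel>x\<parallel>\<close>, and sharpness
  compares them with \<open>m\<close> and \<open>M\<close>.
\<close>

lemma onorm_uzawa_op_eq:
  assumes "0 \<le> m" "m \<le> M" "0 < \<tau>" and lower: "\<And>x. m * norm x \<le> norm (form_op b x)"
    and less: "onorm (uzawa_op b \<tau>) < 1" and sharp: "sharp_bounds b m M"
  shows "onorm (uzawa_op b \<tau>) = max \<bar>1 - \<tau> * m\<^sup>2\<bar> \<bar>1 - \<tau> * M\<^sup>2\<bar>"
proof (rule antisym)
  let ?\<gamma> = "onorm (uzawa_op b \<tau>)"
  show "?\<gamma> \<le> max \<bar>1 - \<tau> * m\<^sup>2\<bar> \<bar>1 - \<tau> * M\<^sup>2\<bar>"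
    using assms by (intro onorm_uzawa_op_le) auto
  have \<gamma>0: "0 \<le> ?\<gamma>"
    by (rule onorm_pos_le[OF bounded_linear_uzawa_op])
  have rayleigh: "(1 - ?\<gamma>) / \<tau> * (norm x)\<^sup>2 \<le> (norm (S x))\<^sup>2"
    "(norm (S x))\<^sup>2 \<le> (1 + ?\<gamma>) / \<tau> * (norm x)\<^sup>2" for x
    using uzawa_quadratic_form_le_onorm[of x \<tau>] \<open>0 < \<tau>\<close> by (auto simp: field_simps abs_le_iff)
  have "sqrt ((1 - ?\<gamma>) / \<tau>) * norm x \<le> norm (form_op b x)" for x
    using real_sqrt_le_mono[OF rayleigh(1)[of x]] by (simp add: real_sqrt_mult real_sqrt_divide norm_S)
  then have "sqrt ((1 - ?\<gamma>) / \<tau>) \<le> m"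
    using sharp by (auto simp: sharp_bounds_def)
  then have "(1 - ?\<gamma>) / \<tau> \<le> m\<^sup>2"
    using sqrt_le_D by blast
  then have lo: "1 - \<tau> * m\<^sup>2 \<le> ?\<gamma>"
    using \<open>0 < \<tau>\<close> by (simp add: field_simps)
  have "norm (form_op b x) \<le> sqrt ((1 + ?\<gamma>) / \<tau>) * norm x" for x
    using real_sqrt_le_mono[OF rayleigh(2)[of x]] by (simp add: real_sqrt_mult real_sqrt_divide norm_S)
  then have "M \<le> sqrt ((1 + ?\<gamma>) / \<tau>)"
    using sharp by (auto simp: sharp_bounds_def)
  then have "M\<^sup>2 \<le> (1 + ?\<gamma>) / \<tau>"
    using M_nonneg \<gamma>0 \<open>0 < \<tau>\<close> power_mono[of M "sqrt ((1 + ?\<gamma>) / \<tau>)" 2] by simp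
  then have hi: "\<tau> * M\<^sup>2 - 1 \<le> ?\<gamma>"
    using \<open>0 < \<tau>\<close> by (simp add: field_simps)
  have "\<tau> * m\<^sup>2 \<le> \<tau> * M\<^sup>2"
    using assms by (intro mult_left_mono power_mono) auto
  then show "max \<bar>1 - \<tau> * m\<^sup>2\<bar> \<bar>1 - \<tau> * M\<^sup>2\<bar> \<le> ?\<gamma>"
    using lo hi by (auto simp: abs_le_iff)
qed

section \<open>Error reduction and the limit\<close>

lemma exact_residual_eq:
  assumes "\<And>v. b us v = blinfun_apply l v"
  shows "exact_residual b l x = - S (x - us)"
proof -
  have "l - form_op b x = - form_op b (x - us)"
    by (rule blinfun_eqI)
      (simp add: blinfun.diff_left blinfun.minus_left form_op_apply bilinear_lsub[OF bilin] assms)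
  then have "exact_residual b l x \<bullet> v = - S (x - us) \<bullet> v" for v
    by (simp add: exact_residual_def inner_riesz_inv S_inner blinfun.minus_left form_op_apply)
  then show ?thesis using vector_eq_rdot by blast
qed

lemma inexact_residual_le:
  assumes sol: "\<And>v. b us v = blinfun_apply l v"
    and "norm (r - exact_residual b l x) \<le> \<delta> * norm (exact_residual b l x)" "0 \<le> \<delta>"
  shows "norm (r - exact_residual b l x) \<le> \<delta> * (M * norm (x - us))"
    and "norm r \<le> (1 + \<delta>) * (M * norm (x - us))"
proof -
  have exact: "norm (exact_residual b l x) \<le> M * norm (x - us)"
    by (simp add: exact_residual_eq[OF sol] norm_S_le)
  then have "\<delta> * norm (exact_residual b l x) \<le> \<delta> * (M * norm (x - us))"
    using \<open>0 \<le> \<delta>\<close> by (rule mult_left_mono)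
  then show *: "norm (r - exact_residual b l x) \<le> \<delta> * (M * norm (x - us))"
    using assms(2) by linarith
  show "norm r \<le> (1 + \<delta>) * (M * norm (x - us))"
    using norm_triangle_sub[of r "exact_residual b l x"] * exact by (simp add: algebra_simps)
qed

text \<open>
  The new error is the sum of three terms: the iteration operator applied to the old error, the
  defect of the residual transported by \<open>\<tau> S\<^sup>*\<close>, and the defect of the update. The bound on the last
  one is relative to the length \<open>\<tau> \<parallel>S\<^sup>* r\<parallel>\<close> of the step.
\<close>

lemma inexact_step_error:
  assumes sol: "\<And>v. b us v = blinfun_apply l v"
    and res: "norm (r - exact_residual b l x) \<le> \<delta> * norm (exact_residual b l x)"
    and upd: "norm (y - exact_update b \<tau> x r) \<le> \<epsilon> * norm (x - exact_update b \<tau> x r)"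
    and "0 \<le> \<delta>" "0 \<le> \<epsilon>" "0 \<le> \<tau>"
  shows "norm (y - us)
    \<le> (onorm (uzawa_op b \<tau>) + \<tau> * M\<^sup>2 * (\<delta> + \<epsilon> * (1 + \<delta>))) * norm (x - us)"
proof -
  let ?e = "norm (x - us)" and ?d = "r - exact_residual b l x"
  have upd_eq: "exact_update b \<tau> x r = x + \<tau> *\<^sub>R S_adj r"
    by (simp add: exact_update_def S_adj_def)
  have "S_adj ?d = S_adj r + S_adj (S (x - us))"
    by (simp add: exact_residual_eq[OF sol] linear_add[OF linear_S_adj])
  then have split: "y - us
      = uzawa_op b \<tau> (x - us) + \<tau> *\<^sub>R S_adj ?d + (y - exact_update b \<tau> x r)"
    by (simp add: upd_eq uzawa_op_eq algebra_simps)
  have step: "norm (\<tau> *\<^sub>R S_adj v) \<le> \<tau> * (M * (c * (M * ?e)))" if "norm v \<le> c * (M * ?e)" for v c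
  proof -
    have "norm (S_adj v) \<le> M * (c * (M * ?e))"
      using norm_S_adj_le[of v] mult_left_mono[OF that M_nonneg] by (rule order_trans)
    then show ?thesis
      using \<open>0 \<le> \<tau>\<close> by (simp add: mult_left_mono)
  qed
  have "norm (x - exact_update b \<tau> x r) \<le> \<tau> * (M * ((1 + \<delta>) * (M * ?e)))"
    using step[OF inexact_residual_le(2)[OF sol res \<open>0 \<le> \<delta>\<close>]] by (simp add: upd_eq)
  then have "norm (y - exact_update b \<tau> x r) \<le> \<epsilon> * (\<tau> * (M * ((1 + \<delta>) * (M * ?e))))"
    using upd \<open>0 \<le> \<epsilon>\<close> by (meson mult_left_mono order_trans)
  then have "norm (y - us) \<le> onorm (uzawa_op b \<tau>) * ?e + \<tau> * (M * (\<delta> * (M * ?e)))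
      + \<epsilon> * (\<tau> * (M * ((1 + \<delta>) * (M * ?e))))"
    unfolding split
    by (intro norm_triangle_mono onorm[OF bounded_linear_uzawa_op]
        step[OF inexact_residual_le(1)[OF sol res \<open>0 \<le> \<delta>\<close>]])
  also have "\<dots> = (onorm (uzawa_op b \<tau>) + \<tau> * M\<^sup>2 * (\<delta> + \<epsilon> * (1 + \<delta>))) * ?e"
    by (simp add: algebra_simps power2_eq_square)
  finally show ?thesis .
qed

text \<open>
  Testing the first equation of the saddle point problem with \<open>r\<close> kills both \<open>b u r\<close> and
  \<open>l r = b us r\<close>, so that \<open>\<parallel>r\<parallel>\<^sup>2 = 0\<close>; the lower bound then makes \<open>u\<close> unique.
\<close>

lemma saddle_point_unique:
  assumes sol: "\<And>v. b us v = blinfun_apply l v"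
    and "0 < m" and lower: "\<And>x. m * norm x \<le> norm (form_op b x)"
    and saddle: "saddle_point b l r u"
  shows "r = 0 \<and> u = us"
proof -
  have 1: "\<And>v. r \<bullet> v + b u v = b us v" and 2: "\<And>w. b w r = 0"
    using saddle sol by (auto simp: saddle_point_def)
  have "r = 0"
    using 1[of r] 2 by simp
  then have "form_op b (u - us) = 0"
    using 1 by (intro blinfun_eqI) (simp add: form_op_apply bilinear_lsub[OF bilin])
  then have "m * norm (u - us) \<le> 0"
    using lower[of "u - us"] by simp
  then show ?thesis
    using \<open>r = 0\<close> \<open>0 < m\<close> by (simp add: mult_le_0_iff)
qed

end

lemma geometric_decay_tendsto_zero:
  fixes a :: "nat \<Rightarrow> real"
  assumes "\<And>k. a (Suc k) \<le> q * a k" "\<And>k. 0 \<le> a k" "0 \<le> q" "q < 1"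
  shows "a \<longlonglongrightarrow> 0"
proof (rule tendsto_sandwich[where f = "\<lambda>_. 0" and h = "\<lambda>k. q ^ k * a 0"])
  have "a k \<le> q ^ k * a 0" for k
  proof (induction k)
    case (Suc k)
    then show ?case
      using order_trans[OF assms(1)[of k] mult_left_mono[OF Suc.IH \<open>0 \<le> q\<close>]]
      by (simp add: mult.assoc)
  qed simp
  then show "\<forall>\<^sub>F k in sequentially. a k \<le> q ^ k * a 0" by simp
  show "(\<lambda>k. q ^ k * a 0) \<longlonglongrightarrow> 0"
    using tendsto_mult_left_zero[OF LIMSEQ_power_zero[of q]] assms by simp
qed (use assms in auto)

theorem theorem4p1:
  fixes b :: "'u::{real_inner, complete_space} \<Rightarrow> 'v::{real_inner, complete_space} \<Rightarrow> real"
    and l :: "'v \<Rightarrow>\<^sub>L real"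
    and m M \<tau> \<delta> \<epsilon> \<gamma> :: real
    and u :: "nat \<Rightarrow> 'u"
    and r :: "nat \<Rightarrow> 'v"
  assumes bilin: "bilinear b"
    and B_welldef: "\<And>x. bounded_linear (b x)"
    and m_pos: "0 < m" and m_le_M: "m \<le> M"
    and B_lower: "\<And>x. m * norm x \<le> norm (form_op b x)"
    and B_upper: "\<And>x. norm (form_op b x) \<le> M * norm x"
    and solvable: "\<exists>x. \<forall>v. b x v = blinfun_apply l v"
    and tau_pos: "0 < \<tau>"
    and residual_approx:
      "\<And>k. norm (r k - exact_residual b l (u k)) \<le> \<delta> * norm (exact_residual b l (u k))"
    and update_approx:
      "\<And>k. norm (u (Suc k) - exact_update b \<tau> (u k) (r k))
             \<le> \<epsilon> * norm (u k - exact_update b \<tau> (u k) (r k))"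
    and delta_pos: "0 < \<delta>" and eps_pos: "0 < \<epsilon>"
    and gamma: "\<gamma> = onorm (uzawa_op b \<tau>)" and gamma_less: "\<gamma> < 1"
    and smallness: "\<delta> + \<epsilon> * (1 + \<delta>) < (1 - \<gamma>) / (\<tau> * M\<^sup>2)"
  shows "(sharp_bounds b m M \<longrightarrow> \<gamma> = max \<bar>1 - \<tau> * m\<^sup>2\<bar> \<bar>1 - \<tau> * M\<^sup>2\<bar>) \<and>
         (\<exists>us rs. saddle_point b l rs us \<and>
            (\<forall>r' u'. saddle_point b l r' u' \<longrightarrow> r' = rs \<and> u' = us) \<and>
            u \<longlonglongrightarrow> us \<and> r \<longlonglongrightarrow> rs)"
proof -
  interpret bounded_form b M
    using m_pos m_le_M by (intro bounded_form.intro bilin B_welldef B_upper) linarith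
  obtain us where sol: "\<And>v. b us v = blinfun_apply l v"
    using solvable by blast
  define q where "q = \<gamma> + \<tau> * M\<^sup>2 * (\<delta> + \<epsilon> * (1 + \<delta>))"
  have "0 < \<tau> * M\<^sup>2"
    using tau_pos m_pos m_le_M by simp
  then have "q < 1"
    using smallness by (simp add: q_def pos_less_divide_eq algebra_simps)
  have "0 \<le> \<gamma>"
    unfolding gamma by (rule onorm_pos_le[OF bounded_linear_uzawa_op])
  then have "0 \<le> q"
    using tau_pos delta_pos eps_pos by (simp add: q_def)
  have "norm (u (Suc k) - us) \<le> q * norm (u k - us)" for k
    unfolding q_def gamma
    using inexact_step_error[OF sol residual_approx update_approx] delta_pos eps_pos tau_pos by simp
  then have error: "(\<lambda>k. norm (u k - us)) \<longlonglongrightarrow> 0"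
    using \<open>0 \<le> q\<close> \<open>q < 1\<close> by (intro geometric_decay_tendsto_zero[where q = q]) auto
  have "r \<longlonglongrightarrow> 0"
  proof (rule Lim_null_comparison)
    show "\<forall>\<^sub>F k in sequentially. norm (r k) \<le> (1 + \<delta>) * (M * norm (u k - us))"
      using inexact_residual_le(2)[OF sol residual_approx] delta_pos by simp
    show "(\<lambda>k. (1 + \<delta>) * (M * norm (u k - us))) \<longlonglongrightarrow> 0"
      by (intro tendsto_mult_right_zero error)
  qed
  moreover have "u \<longlonglongrightarrow> us"
    using error by (rule LIM_zero_cancel[OF tendsto_norm_zero_cancel])
  moreover have "saddle_point b l 0 us"
    using sol by (simp add: saddle_point_def bilinear_rzero[OF bilin])
  moreover have "\<forall>r' u'. saddle_point b l r' u' \<longrightarrow> r' = 0 \<and> u' = us"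
    using saddle_point_unique[OF sol m_pos B_lower] by blast
  moreover have "\<gamma> = max \<bar>1 - \<tau> * m\<^sup>2\<bar> \<bar>1 - \<tau> * M\<^sup>2\<bar>" if "sharp_bounds b m M"
    using onorm_uzawa_op_eq[OF _ m_le_M tau_pos B_lower _ that] m_pos gamma gamma_less by simp
  ultimately show ?thesis
    by blast
qed

end
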